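(* Let $W(t)$, $t\in\mathbb{R}$, be a Gaussian process with almost surely continuous sample paths, continuous mean function $m(t)$ and continuous covariance kernel $\Sigma_{t_1,t_2}$, and assume $\Sigma_{t,s}>0$ for all $s,t\in\mathbb{R}$. Let $\gamma\in\mathbb{R}$ be a constant, $\Phi$ the standard normal cdf, and $$Q(t,W(\cdot))=\int_0^t\Phi(W(y))\,dy-t\gamma .$$ Then the argmin of $Q(t,W(\cdot))$ over $t\in\mathbb{R}$ is unique almost surely (it contains at most one point with probability one).
   Context: $\Phi$ denotes the standard normal cumulative distribution function. *)

theory Defs
  imports "HOL-Probability.Probability"
begin

definition Phi :: "real \<Rightarrow> real" where
  "Phi x = (LBINT y:{..x}. std_normal_density y)"

definition normal_rv :: "'a measure \<Rightarrow> ('a \<Rightarrow> real) \<Rightarrow> real \<Rightarrow> real \<Rightarrow> bool" where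
  "normal_rv M X mu v \<longleftrightarrow> X \<in> borel_measurable M \<and>
     ((v = 0 \<and> (AE x in M. X x = mu)) \<or>
      (v > 0 \<and> distributed M lborel X (normal_density mu (sqrt v))))"

text \<open>W is a Gaussian process with mean function m and covariance kernel K:
  every finite linear combination of W(t) is normal with the corresponding
  mean and variance (equivalently, all finite-dimensional distributions are
  multivariate normal with means m and covariances K).\<close>
definition gaussian_process ::
  "'a measure \<Rightarrow> (real \<Rightarrow> 'a \<Rightarrow> real) \<Rightarrow> (real \<Rightarrow> real) \<Rightarrow> (real \<Rightarrow> real \<Rightarrow> real) \<Rightarrow> bool" where
  "gaussian_process M W m K \<longleftrightarrow>
     (\<forall>I c. finite I \<longrightarrow>
        normal_rv M (\<lambda>\<omega>. \<Sum>t\<in>I. c t * W t \<omega>) (\<Sum>t\<in>I. c t * m t)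
          (\<Sum>s\<in>I. \<Sum>t\<in>I. c s * c t * K s t))"

definition Q :: "real \<Rightarrow> real \<Rightarrow> (real \<Rightarrow> real) \<Rightarrow> real" where
  "Q \<gamma> t w = (LBINT y=ereal 0..ereal t. Phi (w y)) - t * \<gamma>"

definition argmin_set :: "(real \<Rightarrow> real) \<Rightarrow> real set" where
  "argmin_set f = {t. \<forall>s. f t \<le> f s}"

end

theory Submission
  imports Defs
begin

text \<open>
  Split \<open>W t = Z t + h t * W 0\<close>, where \<open>h t = K t 0 / K 0 0 > 0\<close> (with \<open>K\<close> symmetrised) and the residual
  process \<open>Z\<close> is independent of \<open>W 0\<close>. For a fixed path of \<open>Z\<close>, raising the value \<open>x\<close> of \<open>W 0\<close> raises
  \<open>W\<close> everywhere, so \<open>Q t\<close> changes by an amount that is strictly increasing in \<open>t\<close>. Hence, for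
  rationals \<open>a < b < c < d\<close>, the minimum of \<open>Q\<close> over \<open>[c, d]\<close> minus that over \<open>[a, b]\<close> is strictly increasing
  in \<open>x\<close> and vanishes for at most one \<open>x\<close>. As \<open>W 0\<close> has no atoms, the two minima differ almost surely
  (Fubini), whereas two distinct minimisers would make them agree for some choice of \<open>a, b, c, d\<close>.
\<close>

subsection \<open>Paths\<close>

lemma Phi_eq_cdf: "Phi x = cdf std_normal_distribution x"
proof -
  have "cdf std_normal_distribution x = (LINT y|std_normal_distribution. indicator {..x} y)"
    by (simp add: cdf_def)
  also have "\<dots> = (LINT y|lborel. std_normal_density y *\<^sub>R indicator {..x} y)"
    by (rule integral_density) auto
  finally show ?thesis
    by (simp add: Phi_def set_lebesgue_integral_def mult.commute)
qed

text \<open>The increment is the integral of a strictly positive density over an interval of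
  positive length, which is not a null set.\<close>

lemma Phi_less: assumes "x < y" shows "Phi x < Phi y"
proof -
  have int: "set_integrable lborel A std_normal_density" if "A \<in> sets borel" for A
    using integrable_mult_indicator[of A lborel std_normal_density] that
    by (auto simp: set_integrable_def)
  have "Phi y = Phi x + (LBINT z:{x<..y}. std_normal_density z)"
    unfolding Phi_def using assms
    by (subst set_integral_Un[symmetric]) (auto intro!: int arg_cong[where f="\<lambda>A. set_lebesgue_integral _ A _"])
  moreover have "(LBINT z:{x<..y}. std_normal_density z) > 0"
  proof -
    have "(LBINT z:{x<..y}. std_normal_density z) \<noteq> 0"
    proof
      assume "(LBINT z:{x<..y}. std_normal_density z) = 0"
      then have "AE z in lborel. indicator {x<..y} z * std_normal_density z = 0"
        unfolding set_lebesgue_integral_def using int[of "{x<..y}"]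
        by (subst (asm) integral_nonneg_eq_0_iff_AE) (auto simp: set_integrable_def)
      then have "AE z in lborel. z \<notin> {x<..y}"
        by eventually_elim (auto simp: indicator_def normal_density_pos[THEN less_imp_neq, symmetric])
      then have "{x<..y} \<in> null_sets lborel"
        by (subst AE_iff_null_sets) auto
      then show False using assms by auto
    qed
    moreover have "(LBINT z:{x<..y}. std_normal_density z) \<ge> 0"
      unfolding set_lebesgue_integral_def by (intro Bochner_Integration.integral_nonneg) auto
    ultimately show ?thesis by simp
  qed
  ultimately show ?thesis by simp
qed

lemma continuous_on_Phi: "continuous_on UNIV Phi"
proof -
  interpret real_distribution std_normal_distribution
    by (rule real_dist_normal_dist)
  have "measure std_normal_distribution {x} = 0" for x
    by (simp add: measure_density_const measure_def emeasure_density)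
  then show ?thesis
    by (auto simp: Phi_eq_cdf[abs_def] continuous_on_eq_continuous_at isCont_cdf)
qed

lemma DERIV_Q:
  assumes "continuous_on UNIV w"
  shows "((\<lambda>t. Q \<gamma> t w) has_real_derivative Phi (w t) - \<gamma>) (at t)"
proof -
  have c: "continuous_on A (\<lambda>y. Phi (w y))" for A
    using assms continuous_on_Phi by (auto intro: continuous_on_compose2 continuous_on_subset)
  \<comment> \<open>For either sign of \<open>t\<close>, this closed interval contains the base
    point \<open>0\<close> and has \<open>t\<close> in its interior, so the derivative within it is
    the full derivative.\<close>
  have "((\<lambda>t. LBINT y=ereal 0..ereal t. Phi (w y)) has_real_derivative Phi (w t)) (at t within {min 0 (t - 1)..max 0 (t + 1)})"
    unfolding has_real_derivative_iff_has_vector_derivative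
    by (rule interval_integral_FTC2[OF _ _ c]) auto
  moreover have "at t within {min 0 (t - 1)..max 0 (t + 1)} = at t"
    by (rule at_within_interior) auto
  ultimately have "((\<lambda>t. LBINT y=ereal 0..ereal t. Phi (w y)) has_real_derivative Phi (w t)) (at t)"
    by simp
  then show ?thesis unfolding Q_def by (auto intro!: derivative_eq_intros)
qed

lemma continuous_on_Q:
  "continuous_on UNIV w \<Longrightarrow> continuous_on UNIV (\<lambda>t. Q \<gamma> t w)"
  using DERIV_Q DERIV_isCont by (fastforce simp: continuous_on_eq_continuous_at)

text \<open>In the difference the \<open>\<gamma>\<close> terms cancel and the time derivative is
  \<open>Phi (w' x) - Phi (w x) > 0\<close>. The oriented integral makes this valid at negative
  times too.\<close>

lemma Q_diff_less:
  assumes w: "continuous_on UNIV w" and w': "continuous_on UNIV w'"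
    and less: "\<And>y. w y < w' y" and "s < t"
  shows "Q \<gamma> s w' - Q \<gamma> s w < Q \<gamma> t w' - Q \<gamma> t w"
proof (rule DERIV_pos_imp_increasing[OF \<open>s < t\<close>])
  fix x
  show "\<exists>y. ((\<lambda>t. Q \<gamma> t w' - Q \<gamma> t w) has_real_derivative y) (at x) \<and> y > 0"
    using Phi_less[OF less[of x]]
    by (intro exI[of _ "(Phi (w' x) - \<gamma>) - (Phi (w x) - \<gamma>)"]) (intro conjI DERIV_diff DERIV_Q w w'; simp)
qed

section \<open>Infima of \<open>Q\<close> over intervals and their monotonicity in the path\<close>

text \<open>The infimum runs over the rationals so that it is measurable in a parameter of \<open>f\<close>.\<close>

definition rat_inf :: "(real \<Rightarrow> real) \<Rightarrow> real \<Rightarrow> real \<Rightarrow> real" where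
  "rat_inf f a b = (INF t\<in>\<rat> \<inter> {a..b}. f t)"

lemma rat_Icc_nonempty: assumes "a < (b::real)" shows "\<rat> \<inter> {a..b} \<noteq> {}"
  using Rats_dense_in_real[OF assms] by (auto intro: less_imp_le)

lemma bdd_below_rat_Icc:
  fixes f :: "real \<Rightarrow> real"
  assumes "continuous_on UNIV f" shows "bdd_below (f ` (\<rat> \<inter> {a..b}))"
proof -
  have "compact (f ` {a..b})"
    by (intro compact_continuous_image continuous_on_subset[OF assms]) auto
  then have "bdd_below (f ` {a..b})"
    by (intro bounded_imp_bdd_below compact_imp_bounded)
  then show ?thesis by (rule bdd_below_mono) auto
qed

text \<open>Global minimality makes \<open>f t\<close> a lower bound. Conversely, if the infimum
  exceeded \<open>f t\<close>, continuity would give a rational just to the right of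
  \<open>t\<close>, still inside the interval, with value below the infimum. So the rational infimum
  also detects a minimum at an irrational point.\<close>

lemma rat_inf_argmin:
  assumes f: "continuous_on UNIV f" and t: "t \<in> argmin_set f" and "a < t" "t < b"
  shows "rat_inf f a b = f t"
proof (rule antisym)
  show "f t \<le> rat_inf f a b"
    using t rat_Icc_nonempty[of a b] assms(3,4) unfolding rat_inf_def
    by (intro cINF_greatest) (auto simp: argmin_set_def)
  show "rat_inf f a b \<le> f t"
  proof (rule ccontr)
    assume "\<not> ?thesis"
    then have less: "f t < rat_inf f a b" by simp
    have "(f \<longlongrightarrow> f t) (at t)" using f by (simp add: continuous_on_eq_continuous_at isCont_def)
    then have "\<forall>\<^sub>F s in at t. f s < rat_inf f a b" using less by (rule order_tendstoD)
    moreover have "\<forall>\<^sub>F s in at t. s < b" using \<open>t < b\<close> by (rule order_tendstoD[OF tendsto_ident_at])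
    ultimately have "\<forall>\<^sub>F s in at_right t. f s < rat_inf f a b \<and> s < b"
      unfolding eventually_at_split by (simp add: eventually_conj_iff)
    then obtain c where c: "c > t" "\<And>s. t < s \<Longrightarrow> s < c \<Longrightarrow> f s < rat_inf f a b \<and> s < b"
      unfolding eventually_at_right_field by blast
    obtain r where r: "r \<in> \<rat>" "t < r" "r < c" using Rats_dense_in_real[OF c(1)] by blast
    have "rat_inf f a b \<le> f r" unfolding rat_inf_def
      using c(2)[of r] r \<open>a < t\<close> by (intro cINF_lower bdd_below_rat_Icc f) auto
    then show False using c(2)[of r] r by simp
  qed
qed

text \<open>Let \<open>D\<close> be the increase of \<open>Q\<close> from \<open>w\<close> to
  \<open>w'\<close>, which is increasing in time. The infimum over the later interval rises by at
  least \<open>D c\<close>, the one over the earlier interval by at most \<open>D b\<close>, and the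
  gap \<open>b < c\<close> gives \<open>D b < D c\<close>.\<close>

lemma rat_inf_diff_less:
  assumes w: "continuous_on UNIV w" and w': "continuous_on UNIV w'"
    and less: "\<And>y. w y < w' y" and "a < b" "b < c" "c < d"
  shows "rat_inf (\<lambda>t. Q \<gamma> t w) c d - rat_inf (\<lambda>t. Q \<gamma> t w) a b
       < rat_inf (\<lambda>t. Q \<gamma> t w') c d - rat_inf (\<lambda>t. Q \<gamma> t w') a b"
proof -
  define D where "D t = Q \<gamma> t w' - Q \<gamma> t w" for t
  have D: "D s < D t" if "s < t" for s t
    unfolding D_def by (rule Q_diff_less[OF w w' less that])
  have D': "D s \<le> D t" if "s \<le> t" for s t
    using D[of s t] that by (cases "s = t") auto
  have "rat_inf (\<lambda>t. Q \<gamma> t w) c d + D c \<le> rat_inf (\<lambda>t. Q \<gamma> t w') c d"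
    unfolding rat_inf_def[of "\<lambda>t. Q \<gamma> t w'"]
  proof (rule cINF_greatest[OF rat_Icc_nonempty[OF \<open>c < d\<close>]])
    fix r assume r: "r \<in> \<rat> \<inter> {c..d}"
    have "rat_inf (\<lambda>t. Q \<gamma> t w) c d \<le> Q \<gamma> r w"
      unfolding rat_inf_def by (intro cINF_lower bdd_below_rat_Icc continuous_on_Q w r)
    then show "rat_inf (\<lambda>t. Q \<gamma> t w) c d + D c \<le> Q \<gamma> r w'"
      using D'[of c r] r by (simp add: D_def)
  qed
  moreover have "rat_inf (\<lambda>t. Q \<gamma> t w') a b - D b \<le> rat_inf (\<lambda>t. Q \<gamma> t w) a b"
    unfolding rat_inf_def[of "\<lambda>t. Q \<gamma> t w"]
  proof (rule cINF_greatest[OF rat_Icc_nonempty[OF \<open>a < b\<close>]])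
    fix r assume r: "r \<in> \<rat> \<inter> {a..b}"
    have "rat_inf (\<lambda>t. Q \<gamma> t w') a b \<le> Q \<gamma> r w'"
      unfolding rat_inf_def by (intro cINF_lower bdd_below_rat_Icc continuous_on_Q w' r)
    then show "rat_inf (\<lambda>t. Q \<gamma> t w') a b - D b \<le> Q \<gamma> r w"
      using D'[of r b] r by (simp add: D_def)
  qed
  ultimately show ?thesis using D[OF \<open>b < c\<close>] by simp
qed

subsection \<open>Independence from characteristic functions\<close>

context prob_space
begin

text \<open>
  With \<open>C\<close> a bound for \<open>\<bar>h\<bar>\<close>, the law of \<open>X\<close> under the probability density \<open>(h + C) / C\<close> has the same
  characteristic function as the law of \<open>X\<close> under \<open>M\<close>, so Levy's uniqueness theorem applies.
\<close>

lemma expectation_indicator_eq_0_real: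
  fixes h :: "'a \<Rightarrow> real"
  assumes h[measurable]: "h \<in> borel_measurable M" and X[measurable]: "X \<in> borel_measurable M"
    and bdd: "\<And>x. \<bar>h x\<bar> \<le> B"
    and zero: "\<And>t. (CLINT x|M. complex_of_real (h x) * iexp (t * X x)) = 0"
    and A[measurable]: "A \<in> sets borel"
  shows "(LINT x|M. h x * indicator A (X x)) = 0"
proof -
  \<comment> \<open>The bound \<open>B\<close> is nonnegative but may be \<open>0\<close>; adding
    \<open>1\<close> allows division by \<open>C\<close>.\<close>
  define C where "C = B + 1"
  have hC: "0 \<le> h x + C" and C: "C > 0" for x
    using bdd[of x] unfolding C_def by linarith+
  define f where "f x = (h x + C) / C" for x
  have f[measurable]: "f \<in> borel_measurable M" unfolding f_def by measurable
  have f0: "0 \<le> f x" for x using hC C by (simp add: f_def)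
  have ih: "integrable M (\<lambda>x. complex_of_real (h x) * iexp (t * X x))" for t
    by (rule integrable_const_bound[of _ B]) (auto simp: norm_mult bdd)
  have ihA: "integrable M (\<lambda>x. h x * indicator A' (X x))" if [measurable]: "A' \<in> sets borel" for A'
    by (rule integrable_const_bound[of _ B]) (auto simp: bdd indicator_def order_trans[OF abs_ge_zero bdd])
  have ie: "integrable M (\<lambda>x. iexp (t * X x))" for t
    by (rule integrable_const_bound[of _ 1]) auto
  define M1 where "M1 = distr (density M f) borel X"
  define M2 where "M2 = distr M borel X"
  have h_int: "integrable M h" using ihA[of UNIV] by simp
  then have f_int: "integrable M f" by (simp add: f_def[abs_def])
  \<comment> \<open>Frequency \<open>0\<close> shows that \<open>h\<close> has mean zero, so
    \<open>f\<close> integrates to one.\<close>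
  have "(CLINT x|M. complex_of_real (h x)) = 0" using zero[of 0] by simp
  then have h0: "(LINT x|M. h x) = 0" by simp
  have "emeasure (density M f) (space M) = ennreal (LINT x|M. f x)"
    using f0 f_int by (subst emeasure_density) (auto intro!: nn_integral_eq_integral cong: nn_integral_cong_simp)
  also have "(LINT x|M. f x) = 1"
    using h_int h0 C by (simp add: f_def prob_space)
  finally have P: "prob_space (density M f)" by (intro prob_spaceI) simp
  have 1: "real_distribution M1" unfolding M1_def
    by (intro prob_space.real_distribution_distr P) measurable
  have 2: "real_distribution M2" unfolding M2_def
    by (intro real_distribution_distr) measurable
  have "char M1 t = char M2 t" for t
  proof -
    have "char M1 t = (CLINT x|M. f x *\<^sub>R iexp (t * X x))"
      unfolding M1_def char_def using f0 by (subst integral_distr) (auto simp: integral_density)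
    also have "\<dots> = (CLINT x|M. (complex_of_real (h x) * iexp (t * X x)) / C + iexp (t * X x))"
      using C by (intro Bochner_Integration.integral_cong) (auto simp: f_def scaleR_conv_of_real field_simps)
    also have "\<dots> = (CLINT x|M. iexp (t * X x))"
      using ih ie zero by simp
    also have "\<dots> = char M2 t"
      unfolding M2_def char_def by (subst integral_distr) auto
    finally show ?thesis .
  qed
  then have eq: "M1 = M2" by (intro Levy_uniqueness 1 2) auto
  have "(LINT x|M. f x * indicator A (X x)) = (LINT y|M1. indicator A y)"
    unfolding M1_def using f0 by (subst integral_distr) (auto simp: integral_density)
  also have "\<dots> = (LINT x|M. indicator A (X x))"
    unfolding eq M2_def by (subst integral_distr) auto
  \<comment> \<open>Since \<open>f = h / C + 1\<close>, the plain indicator term occurs on both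
    sides and cancels, leaving the integral with \<open>h\<close>.\<close>
  also have "(LINT x|M. f x * indicator A (X x)) = (LINT x|M. (h x * indicator A (X x)) / C + indicator A (X x))"
    using C by (intro Bochner_Integration.integral_cong) (auto simp: f_def field_simps)
  also have "\<dots> = (LINT x|M. h x * indicator A (X x)) / C + (LINT x|M. indicator A (X x))"
    using ihA[OF A] by (subst Bochner_Integration.integral_add) (auto intro!: integrable_const_bound[of _ 1] simp: indicator_def)
  finally show ?thesis using C by simp
qed

text \<open>Conjugating the hypothesis at frequency \<open>- t\<close> gives it for
  \<open>cnj h\<close> at \<open>t\<close>. By linearity it then holds for the real and imaginary
  parts of \<open>h\<close>, to which the real case applies.\<close>

lemma expectation_indicator_eq_0:
  fixes h :: "'a \<Rightarrow> complex"
  assumes h[measurable]: "h \<in> borel_measurable M" and X[measurable]: "X \<in> borel_measurable M"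
    and bdd: "\<And>x. norm (h x) \<le> B"
    and zero: "\<And>t. (CLINT x|M. h x * iexp (t * X x)) = 0"
    and A[measurable]: "A \<in> sets borel"
  shows "(CLINT x|M. h x * indicator A (X x)) = 0"
proof -
  have i: "integrable M (\<lambda>x. h x * iexp (t * X x))" for t
    by (rule integrable_const_bound[of _ B]) (auto simp: norm_mult bdd)
  have [measurable]: "(\<lambda>x. cnj (h x)) \<in> borel_measurable M"
    by (rule measurable_compose[OF h borel_measurable_continuous_onI]) (intro continuous_intros)
  have ic: "integrable M (\<lambda>x. cnj (h x) * iexp (t * X x))" for t
    by (rule integrable_const_bound[of _ B]) (auto simp: norm_mult bdd)
  have zc: "(CLINT x|M. cnj (h x) * iexp (t * X x)) = 0" for t
  proof -
    have "cnj (h x) * iexp (t * X x) = cnj (h x * iexp ((- t) * X x))" for x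
      by (simp add: exp_cnj)
    then have "(CLINT x|M. cnj (h x) * iexp (t * X x)) = cnj (CLINT x|M. h x * iexp ((-t) * X x))"
      by (simp only: Bochner_Integration.integral_cnj)
    then show ?thesis using zero[of "- t"] by simp
  qed
  have "(CLINT x|M. complex_of_real (Re (h x)) * iexp (t * X x)) = 0" for t
  proof -
    have "complex_of_real (Re (h x)) * iexp (t * X x) = (h x * iexp (t * X x) + cnj (h x) * iexp (t * X x)) / 2" for x
      by (simp add: complex_add_cnj flip: distrib_right)
    then show ?thesis by (simp only: integral_divide_zero
        Bochner_Integration.integral_add[OF i ic] zero zc) simp
  qed
  then have Re0: "(LINT x|M. Re (h x) * indicator A (X x)) = 0"
    using bdd order_trans[OF abs_Re_le_cmod] by (intro expectation_indicator_eq_0_real[of _ _ B]) auto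
  have "(CLINT x|M. complex_of_real (Im (h x)) * iexp (t * X x)) = 0" for t
  proof -
    have "complex_of_real (Im (h x)) * iexp (t * X x) = (h x * iexp (t * X x) - cnj (h x) * iexp (t * X x)) / (2 * \<i>)" for x
    proof -
      have "complex_of_real (Im (h x)) = (h x - cnj (h x)) / (2 * \<i>)"
        by (simp add: complex_diff_cnj) (simp add: complex_eq_iff)
      then show ?thesis by (simp only: left_diff_distrib times_divide_eq_left)
    qed
    then show ?thesis by (simp only: integral_divide_zero
        Bochner_Integration.integral_diff[OF i ic] zero zc) simp
  qed
  then have Im0: "(LINT x|M. Im (h x) * indicator A (X x)) = 0"
    using bdd order_trans[OF abs_Im_le_cmod] by (intro expectation_indicator_eq_0_real[of _ _ B]) auto
  have iA: "integrable M (\<lambda>x. h x * indicator A (X x))"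
    by (rule integrable_const_bound[of _ B]) (auto simp: norm_mult bdd indicator_def order_trans[OF norm_ge_zero bdd])
  have "Re (h x * indicator A (X x)) = Re (h x) * indicator A (X x)"
    "Im (h x * indicator A (X x)) = Im (h x) * indicator A (X x)" for x
    by (auto simp: indicator_def)
  then have "Re (CLINT x|M. h x * indicator A (X x)) = 0" "Im (CLINT x|M. h x * indicator A (X x)) = 0"
    using Re0 Im0 by (simp_all only: integral_Re[OF iA, symmetric] integral_Im[OF iA, symmetric])
  then show ?thesis by (simp add: complex_eq_iff)
qed

text \<open>The variables are treated one at a time. The exponential in \<open>X j\<close> is
  absorbed into \<open>h\<close>, which stays bounded by \<open>B\<close>, so the induction
  hypothesis handles the other variables; the one-variable lemma then trades that exponential for
  the indicator of \<open>A j\<close>. This is why the induction runs over arbitrary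
  \<open>h\<close>.\<close>

lemma expectation_prod_indicator_eq_0:
  fixes h :: "'a \<Rightarrow> complex" and X :: "'i \<Rightarrow> 'a \<Rightarrow> real"
  assumes "finite I" and X: "\<And>i. X i \<in> borel_measurable M"
    and A: "\<And>i. A i \<in> sets borel"
    and h: "h \<in> borel_measurable M" "\<And>x. norm (h x) \<le> B"
    and zero: "\<And>c. (CLINT x|M. h x * iexp (\<Sum>i\<in>I. c i * X i x)) = 0"
  shows "(CLINT x|M. h x * (\<Prod>i\<in>I. indicator (A i) (X i x))) = 0"
  using assms(1) h zero
proof (induction I arbitrary: h)
  case (insert j I)
  note [measurable] = X A insert.prems(1)
  have "(CLINT x|M. (h x * (\<Prod>i\<in>I. indicator (A i) (X i x))) * iexp (t * X j x)) = 0" for t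
  proof -
    have "(CLINT x|M. (h x * iexp (t * X j x)) * (\<Prod>i\<in>I. indicator (A i) (X i x))) = 0"
    proof (rule insert.IH)
      fix c
      have *: "(\<Sum>i\<in>insert j I. (c(j := t)) i * X i x) = t * X j x + (\<Sum>i\<in>I. c i * X i x)" for x
        using insert.hyps by (auto intro!: sum.cong)
      show "(CLINT x|M. (h x * iexp (t * X j x)) * iexp (\<Sum>i\<in>I. c i * X i x)) = 0"
        using insert.prems(3)[of "c(j := t)"] unfolding *
        by (simp add: exp_add distrib_left mult.assoc)
    qed (auto simp: norm_mult insert.prems)
    then show ?thesis by (simp add: mult_ac)
  qed
  moreover have "norm (h x * (\<Prod>i\<in>I. indicator (A i) (X i x))) \<le> B" for x
  proof -
    have "norm (\<Prod>i\<in>I. indicator (A i) (X i x) :: complex) \<le> 1"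
      by (simp add: prod_le_1 indicator_def flip: prod_norm)
    then show ?thesis
      using mult_mono[OF insert.prems(2)[of x], of _ 1] insert.prems(2)[of x] norm_ge_zero[of "h x"]
      by (simp add: norm_mult)
  qed
  ultimately have "(CLINT x|M. (h x * (\<Prod>i\<in>I. indicator (A i) (X i x))) * indicator (A j) (X j x)) = 0"
    by (intro expectation_indicator_eq_0[of _ _ B]) auto
  then show ?case using insert.hyps by (simp add: mult_ac)
qed simp

section \<open>The sigma-algebra generated by a process and its independence of a variable\<close>

text \<open>This is the sigma-algebra generated by the family \<open>X\<close>, kept on the original
  sample space instead of a space of functions: a sample point then still has a continuous path, and
  the identity map plays the role of the whole process. Finite cylinders are used as generators
  because they form a pi-system.\<close>

definition cylinder_algebra :: "('i \<Rightarrow> 'a \<Rightarrow> real) \<Rightarrow> 'a measure" where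
  "cylinder_algebra X = sigma (space M)
     {{\<omega> \<in> space M. \<forall>i\<in>I. X i \<omega> \<in> A i} | I A. finite I \<and> (\<forall>i. A i \<in> sets borel)}"

lemma space_cylinder_algebra [simp]: "space (cylinder_algebra X) = space M"
  unfolding cylinder_algebra_def by (rule space_measure_of) auto

lemma sets_cylinder_algebra:
  "sets (cylinder_algebra X) = sigma_sets (space M)
     {{\<omega> \<in> space M. \<forall>i\<in>I. X i \<omega> \<in> A i} | I A. finite I \<and> (\<forall>i. A i \<in> sets borel)}"
  unfolding cylinder_algebra_def by (rule sets_measure_of) auto

lemma measurable_cylinder_algebra:
  "X i \<in> borel_measurable (cylinder_algebra X)"
proof (rule measurableI)
  fix A :: "real set" assume "A \<in> sets borel"
  then show "X i -` A \<inter> space (cylinder_algebra X) \<in> sets (cylinder_algebra X)"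
    unfolding sets_cylinder_algebra
    by (intro sigma_sets.Basic CollectI exI[of _ "{i}"] exI[of _ "\<lambda>_. A"]) auto
qed simp

lemma Int_stable_cylinders:
  "Int_stable {{\<omega> \<in> space M. \<forall>i\<in>I. X i \<omega> \<in> A i} | I (A :: 'i \<Rightarrow> real set).
     finite I \<and> (\<forall>i. A i \<in> sets borel)}"
proof (rule Int_stableI, safe)
  fix I J :: "'i set" and A B :: "'i \<Rightarrow> real set"
  assume "finite I" "finite J" "\<forall>i. A i \<in> sets borel" "\<forall>i. B i \<in> sets borel"
  then show "\<exists>L C. {\<omega> \<in> space M. \<forall>i\<in>I. X i \<omega> \<in> A i} \<inter> {\<omega> \<in> space M. \<forall>i\<in>J. X i \<omega> \<in> B i}
      = {\<omega> \<in> space M. \<forall>i\<in>L. X i \<omega> \<in> C i} \<and> finite L \<and> (\<forall>i. C i \<in> sets borel)"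
    \<comment> \<open>On the union of the index sets, a coordinate absent from one cylinder gets the
      vacuous constraint \<open>UNIV\<close> from it.\<close>
    by (intro exI[of _ "I \<union> J"] exI[of _ "\<lambda>i. (if i \<in> I then A i else UNIV) \<inter> (if i \<in> J then B i else UNIV)"])
       auto
qed

text \<open>
  The conclusion is \<open>indep_var\<close> spelled out, since that constant requires both variables to have
  the same type.
\<close>

lemma indep_cylinder_algebra:
  fixes X :: "'i \<Rightarrow> 'a \<Rightarrow> real" and Y :: "'a \<Rightarrow> real"
  assumes X[measurable]: "\<And>i. X i \<in> borel_measurable M" and Y[measurable]: "Y \<in> borel_measurable M"
    and factor: "\<And>I c t. finite I \<Longrightarrow> expectation (\<lambda>\<omega>. iexp ((\<Sum>i\<in>I. c i * X i \<omega>) + t * Y \<omega>)) =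
       expectation (\<lambda>\<omega>. iexp (\<Sum>i\<in>I. c i * X i \<omega>)) * expectation (\<lambda>\<omega>. iexp (t * Y \<omega>))"
  shows "(\<lambda>\<omega>. \<omega>) \<in> M \<rightarrow>\<^sub>M cylinder_algebra X"
    and "distr M (cylinder_algebra X) (\<lambda>\<omega>. \<omega>) \<Otimes>\<^sub>M distr M borel Y =
      distr M (cylinder_algebra X \<Otimes>\<^sub>M borel) (\<lambda>\<omega>. (\<omega>, Y \<omega>))"
proof -
  let ?G = "{{\<omega> \<in> space M. \<forall>i\<in>I. X i \<omega> \<in> A i} | I A. finite I \<and> (\<forall>i. A i \<in> sets borel)}"
  let ?H = "{Y -` B \<inter> space M | B. B \<in> sets borel}"
  have cyl: "{\<omega> \<in> space M. \<forall>i\<in>I. X i \<omega> \<in> A i} \<in> events"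
    if [measurable]: "finite I" "\<forall>i. A i \<in> sets borel" for I A
    by measurable
  have indep: "prob ({\<omega> \<in> space M. \<forall>i\<in>I. X i \<omega> \<in> A i} \<inter> (Y -` B \<inter> space M)) =
      prob {\<omega> \<in> space M. \<forall>i\<in>I. X i \<omega> \<in> A i} * prob (Y -` B \<inter> space M)"
    if I: "finite I" and A[measurable]: "\<forall>i. A i \<in> sets borel" and B[measurable]: "B \<in> sets borel" for I A B
  proof -
    let ?C = "{\<omega> \<in> space M. \<forall>i\<in>I. X i \<omega> \<in> A i}" and ?D = "Y -` B \<inter> space M"
    have CD: "?C \<in> events" "?D \<in> events" "?C \<inter> ?D \<in> events"
      using cyl[OF I A] measurable_sets[OF Y B] by auto
    define b where "b = complex_of_real (prob ?D)"
    have Eb: "expectation (\<lambda>\<omega>. indicator B (Y \<omega>)) = b"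
    proof -
      have "expectation (\<lambda>\<omega>. indicator B (Y \<omega>) :: complex) = expectation (\<lambda>\<omega>. complex_of_real (indicator ?D \<omega>))"
        by (intro Bochner_Integration.integral_cong) (auto simp: indicator_def)
      also have "\<dots> = b" unfolding b_def using CD(2) by (simp add: Int_absorb1 Int_commute)
      finally show ?thesis .
    qed
    \<comment> \<open>Centring the indicator of \<open>B\<close> at its mean turns the product rule
      into a vanishing integral, which need only be checked against exponentials of linear
      combinations of the \<open>X i\<close>.\<close>
    have "expectation (\<lambda>\<omega>. (indicator B (Y \<omega>) - b) * (\<Prod>i\<in>I. indicator (A i) (X i \<omega>))) = 0"
    proof (rule expectation_prod_indicator_eq_0[OF I X, where B = "1 + norm b"])
      show "norm (indicator B (Y x) - b) \<le> 1 + norm b" for x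
        by (rule order_trans[OF norm_triangle_ineq4]) (auto simp: indicator_def)
      fix c
      define F where "F \<omega> = iexp (\<Sum>i\<in>I. c i * X i \<omega>)" for \<omega>
      have [measurable]: "F \<in> borel_measurable M" unfolding F_def by measurable
      have nF: "norm (F \<omega>) = 1" for \<omega> unfolding F_def by simp
      have iF: "integrable M F"
        by (rule integrable_const_bound[of _ 1]) (auto simp: nF)
      have iFt: "integrable M (\<lambda>x. F x * iexp (t * Y x))" for t
        by (rule integrable_const_bound[of _ 1]) (auto simp: nF norm_mult)
      have it: "integrable M (\<lambda>x. iexp (t * Y x))" for t
        by (rule integrable_const_bound[of _ 1]) auto
      have iFB: "integrable M (\<lambda>x. F x * indicator B (Y x))"
        by (rule integrable_const_bound[of _ 1]) (auto simp: nF norm_mult indicator_def)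
      have iB: "integrable M (\<lambda>x. indicator B (Y x) :: complex)"
        by (rule integrable_const_bound[of _ 1]) (auto simp: indicator_def)
      \<comment> \<open>The same device with the roles exchanged: once \<open>F\<close> is centred,
        \<open>factor\<close> supplies the hypothesis of the one-variable lemma for
        \<open>Y\<close>.\<close>
      have "expectation (\<lambda>\<omega>. (F \<omega> - expectation F) * indicator B (Y \<omega>)) = 0"
      proof (rule expectation_indicator_eq_0[where B = "1 + norm (expectation F)"])
        show "norm (F x - expectation F) \<le> 1 + norm (expectation F)" for x
          by (rule order_trans[OF norm_triangle_ineq4]) (auto simp: nF)
        fix t
        have "expectation (\<lambda>\<omega>. F \<omega> * iexp (t * Y \<omega>)) = expectation F * expectation (\<lambda>\<omega>. iexp (t * Y \<omega>))"
          using factor[OF I, of c t] by (simp add: F_def[abs_def] exp_add distrib_left)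
        then show "expectation (\<lambda>\<omega>. (F \<omega> - expectation F) * iexp (t * Y \<omega>)) = 0"
          using iFt[of t] it[of t] by (simp add: left_diff_distrib)
      qed auto
      then have "expectation (\<lambda>\<omega>. F \<omega> * indicator B (Y \<omega>)) = expectation F * b"
        using iFB iB by (simp add: left_diff_distrib Eb)
      moreover have "expectation (\<lambda>\<omega>. (indicator B (Y \<omega>) - b) * F \<omega>)
          = expectation (\<lambda>\<omega>. F \<omega> * indicator B (Y \<omega>)) - expectation F * b"
        using iFB iF by (simp add: right_diff_distrib mult.commute[of _ "F _"])
      ultimately show "expectation (\<lambda>\<omega>. (indicator B (Y \<omega>) - b) * iexp (\<Sum>i\<in>I. c i * X i \<omega>)) = 0"
        by (simp add: F_def)
    qed (use A in auto)
    moreover have "(indicator B (Y \<omega>) - b) * (\<Prod>i\<in>I. indicator (A i) (X i \<omega>))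
        = complex_of_real (indicator (?C \<inter> ?D) \<omega>) - b * complex_of_real (indicator ?C \<omega>)"
      if "\<omega> \<in> space M" for \<omega>
    proof -
      have "(\<Prod>i\<in>I. indicator (A i) (X i \<omega>)) = complex_of_real (indicator ?C \<omega>)"
        using I that by (auto simp: indicator_def)
      then show ?thesis using that by (auto simp: indicator_def)
    qed
    ultimately have "expectation (\<lambda>\<omega>. complex_of_real (indicator (?C \<inter> ?D) \<omega>) - b * complex_of_real (indicator ?C \<omega>)) = 0"
      by (simp cong: Bochner_Integration.integral_cong)
    moreover have "integrable M (\<lambda>\<omega>. complex_of_real (indicator S \<omega>))" if "S \<in> events" for S
      using that by (intro integrable_const_bound[of _ 1]) (auto simp: indicator_def)
    moreover have "expectation (\<lambda>\<omega>. complex_of_real (indicator S \<omega>)) = prob S" if "S \<in> events" for S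
      using that sets.sets_into_space[OF that] by (simp add: Int_absorb2)
    ultimately have "complex_of_real (prob (?C \<inter> ?D)) = b * prob ?C"
      using CD by (simp del: of_real_indicator)
    then show ?thesis
      unfolding b_def by (simp add: mult.commute flip: of_real_mult)
  qed
  have "indep_set ?G ?H"
  proof (rule indep_setI)
    show "?G \<subseteq> events" using cyl by blast
    show "?H \<subseteq> events" using measurable_sets[OF Y] by blast
  qed (use indep in blast)
  moreover have "Int_stable ?H"
  proof (rule Int_stableI, safe)
    fix A B :: "real set" assume "A \<in> sets borel" "B \<in> sets borel"
    then show "\<exists>C. Y -` A \<inter> space M \<inter> (Y -` B \<inter> space M) = Y -` C \<inter> space M \<and> C \<in> sets borel"
      by (intro exI[of _ "A \<inter> B"]) auto
  qed
  \<comment> \<open>Both generators are closed under intersection, so independence extends to the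
    sigma-algebras they generate.\<close>
  ultimately have *: "indep_set (sigma_sets (space M) ?G) (sigma_sets (space M) ?H)"
    by (intro indep_set_sigma_sets Int_stable_cylinders)
  have G: "sets (cylinder_algebra X) \<subseteq> events"
    unfolding sets_cylinder_algebra by (rule sets.sigma_sets_subset) (use cyl in blast)
  then show id[measurable]: "(\<lambda>\<omega>. \<omega>) \<in> M \<rightarrow>\<^sub>M cylinder_algebra X"
    using sets.sets_into_space by (intro measurableI) (auto simp: Int_absorb2)
  interpret D1: prob_space "distr M (cylinder_algebra X) (\<lambda>\<omega>. \<omega>)" by (rule prob_space_distr) measurable
  interpret D2: prob_space "distr M borel Y" by (rule prob_space_distr) measurable
  show "distr M (cylinder_algebra X) (\<lambda>\<omega>. \<omega>) \<Otimes>\<^sub>M distr M borel Y =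
      distr M (cylinder_algebra X \<Otimes>\<^sub>M borel) (\<lambda>\<omega>. (\<omega>, Y \<omega>))"
  proof (rule pair_measure_eqI)
    show "sigma_finite_measure (distr M (cylinder_algebra X) (\<lambda>\<omega>. \<omega>))" ..
    show "sigma_finite_measure (distr M borel Y)" ..
    show "sets (distr M (cylinder_algebra X) (\<lambda>\<omega>. \<omega>) \<Otimes>\<^sub>M distr M borel Y) =
        sets (distr M (cylinder_algebra X \<Otimes>\<^sub>M borel) (\<lambda>\<omega>. (\<omega>, Y \<omega>)))"
      by (simp cong: sets_pair_measure_cong)
    fix A B
    assume "A \<in> sets (distr M (cylinder_algebra X) (\<lambda>\<omega>. \<omega>))" "B \<in> sets (distr M borel Y)"
    then have A[measurable]: "A \<in> sets (cylinder_algebra X)" and B[measurable]: "B \<in> sets borel"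
      by auto
    have "prob (A \<inter> (Y -` B \<inter> space M)) = prob A * prob (Y -` B \<inter> space M)"
    proof (rule indep_setD[OF *])
      show "A \<in> sigma_sets (space M) ?G" using A by (simp only: sets_cylinder_algebra)
      show "Y -` B \<inter> space M \<in> sigma_sets (space M) ?H" using B by (blast intro: sigma_sets.Basic)
    qed
    moreover have "(\<lambda>\<omega>. (\<omega>, Y \<omega>)) -` (A \<times> B) \<inter> space M = A \<inter> (Y -` B \<inter> space M)"
      "(\<lambda>\<omega>. \<omega>) -` A \<inter> space M = A"
      using sets.sets_into_space[OF A] by auto
    ultimately show "emeasure (distr M (cylinder_algebra X) (\<lambda>\<omega>. \<omega>)) A * emeasure (distr M borel Y) B =
        emeasure (distr M (cylinder_algebra X \<Otimes>\<^sub>M borel) (\<lambda>\<omega>. (\<omega>, Y \<omega>))) (A \<times> B)"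
      by (simp add: emeasure_distr emeasure_eq_measure ennreal_mult)
  qed
qed

text \<open>For \<open>v > 0\<close> write \<open>X = mu + sqrt v * Y\<close> with \<open>Y\<close>
  standard normal and evaluate its characteristic function at \<open>sqrt v\<close>. The degenerate
  case \<open>v = 0\<close> does occur: the residual process vanishes at the conditioning
  time.\<close>

lemma normal_rv_iexp:
  assumes "normal_rv M X mu v"
  shows "expectation (\<lambda>\<omega>. iexp (X \<omega>)) = exp (\<i> * mu - v / 2)"
proof -
  have X[measurable]: "X \<in> borel_measurable M" using assms by (simp add: normal_rv_def)
  from assms consider "v = 0" "AE \<omega> in M. X \<omega> = mu"
    | "v > 0" "distributed M lborel X (normal_density mu (sqrt v))"
    by (auto simp: normal_rv_def)
  then show ?thesis
  proof cases
    case 1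
    have "expectation (\<lambda>\<omega>. iexp (X \<omega>)) = expectation (\<lambda>\<omega>. iexp mu)"
      using 1(2) by (intro integral_cong_AE) auto
    then show ?thesis using 1 by (simp add: prob_space)
  next
    case 2
    define Y where "Y \<omega> = (X \<omega> - mu) / sqrt v" for \<omega>
    have [measurable]: "Y \<in> borel_measurable M" unfolding Y_def by measurable
    have "distributed M lborel Y std_normal_density"
      unfolding Y_def using 2 by (subst normal_standard_normal_convert[symmetric]) auto
    then have Y: "distr M lborel Y = std_normal_distribution"
      by (simp add: distributed_def)
    have "expectation (\<lambda>\<omega>. iexp (X \<omega>)) = expectation (\<lambda>\<omega>. iexp mu * iexp (sqrt v * Y \<omega>))"
      using 2(1) by (intro Bochner_Integration.integral_cong) (auto simp: Y_def simp flip: exp_add distrib_left of_real_mult of_real_add)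
    also have "\<dots> = iexp mu * expectation (\<lambda>\<omega>. iexp (sqrt v * Y \<omega>))"
      by simp
    also have "expectation (\<lambda>\<omega>. iexp (sqrt v * Y \<omega>)) = char (distr M lborel Y) (sqrt v)"
      unfolding char_def by (subst integral_distr) auto
    also have "\<dots> = exp (- v / 2)"
      using 2(1) by (simp add: Y char_std_normal_distribution)
    also have "iexp mu * complex_of_real (exp (- v / 2)) = exp (\<i> * mu - v / 2)"
      by (simp flip: exp_add exp_of_real)
    finally show ?thesis .
  qed
qed

end

subsection \<open>Gaussian processes\<close>

lemma sum_indicator_mult:
  assumes "finite J" "r \<in> J"
  shows "(\<Sum>t\<in>J. (if t = r then x else 0) * f t) = x * (f r :: real)"
  using assms by (subst sum.remove[of _ r]) (auto intro!: sum.neutral)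

text \<open>This is the variance of a linear combination after adding \<open>x\<close> to the
  coefficient at \<open>r\<close>. Both \<open>K s r\<close> and \<open>K r s\<close> appear because
  \<open>K\<close> is not assumed symmetric.\<close>

lemma quadratic_form_shift:
  fixes K :: "'i \<Rightarrow> 'i \<Rightarrow> real"
  assumes J: "finite J" "r \<in> J"
  shows "(\<Sum>s\<in>J. \<Sum>t\<in>J. (d s + (if s = r then x else 0)) * (d t + (if t = r then x else 0)) * K s t)
    = (\<Sum>s\<in>J. \<Sum>t\<in>J. d s * d t * K s t) + x * (\<Sum>s\<in>J. d s * (K s r + K r s)) + x\<^sup>2 * K r r"
proof -
  define e where "e s = (if s = r then x else 0)" for s
  have e: "(\<Sum>t\<in>J. e t * f t) = x * f r" for f :: "'i \<Rightarrow> real"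
    unfolding e_def by (rule sum_indicator_mult[OF J])
  have "(\<Sum>s\<in>J. \<Sum>t\<in>J. (d s + e s) * (d t + e t) * K s t)
      = (\<Sum>s\<in>J. \<Sum>t\<in>J. d s * d t * K s t) + (\<Sum>s\<in>J. d s * (\<Sum>t\<in>J. e t * K s t))
        + (\<Sum>s\<in>J. e s * (\<Sum>t\<in>J. d t * K s t)) + (\<Sum>s\<in>J. e s * (\<Sum>t\<in>J. e t * K s t))"
    by (simp add: sum_distrib_left algebra_simps flip: sum.distrib)
  also have "\<dots> = (\<Sum>s\<in>J. \<Sum>t\<in>J. d s * d t * K s t) + x * (\<Sum>s\<in>J. d s * (K s r + K r s)) + x\<^sup>2 * K r r"
    by (simp only: e) (simp add: sum_distrib_left algebra_simps power2_eq_square flip: sum.distrib)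
  finally show ?thesis unfolding e_def .
qed

context prob_space
begin

text \<open>The regression coefficient \<open>h\<close> makes the residuals uncorrelated with
  \<open>W r\<close> for the symmetrised kernel. The cross term in the variance therefore vanishes,
  and the Gaussian exponent splits into two summands.\<close>

lemma gaussian_residual_iexp:
  fixes W :: "real \<Rightarrow> 'a \<Rightarrow> real"
  assumes G: "gaussian_process M W m K" and K: "K r r > 0" and I: "finite I"
  defines "h \<equiv> \<lambda>t. (K t r + K r t) / (2 * K r r)"
  shows "expectation (\<lambda>\<omega>. iexp ((\<Sum>t\<in>I. c t * (W t \<omega> - h t * W r \<omega>)) + x * W r \<omega>)) =
     expectation (\<lambda>\<omega>. iexp (\<Sum>t\<in>I. c t * (W t \<omega> - h t * W r \<omega>))) * expectation (\<lambda>\<omega>. iexp (x * W r \<omega>))"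
proof -
  define J where "J = insert r I"
  have J: "finite J" "r \<in> J" using I by (auto simp: J_def)
  \<comment> \<open>Expanding the residuals, \<open>H\<close> is the total weight subtracted from
    \<open>W r\<close>, so \<open>d\<close> lists the coefficients with respect to \<open>W\<close>.
    They live on \<open>J\<close>, since \<open>r\<close> may lie outside \<open>I\<close>.\<close>
  define H where "H = (\<Sum>t\<in>I. c t * h t)"
  define d where "d t = (if t \<in> I then c t else 0) + (if t = r then - H else 0)" for t
  define V where "V a = (\<Sum>s\<in>J. \<Sum>t\<in>J. a s * a t * K s t)" for a
  define \<mu> where "\<mu> a = (\<Sum>t\<in>J. a t * m t)" for a
  have E: "expectation (\<lambda>\<omega>. iexp (\<Sum>t\<in>J. a t * W t \<omega>)) = exp (\<i> * \<mu> a - V a / 2)" for a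
    unfolding V_def \<mu>_def by (rule normal_rv_iexp) (use G J in \<open>auto simp: gaussian_process_def\<close>)
  have dsum: "(\<Sum>t\<in>J. d t * f t) = (\<Sum>t\<in>I. c t * f t) - H * f r" for f
  proof -
    have "(\<Sum>t\<in>J. (if t \<in> I then c t else 0) * f t) = (\<Sum>t\<in>I. c t * f t)"
      unfolding J_def using I by (intro sum.mono_neutral_cong_right) auto
    then show ?thesis
      unfolding d_def by (simp only: distrib_right sum.distrib sum_indicator_mult[OF J])
  qed
  have L: "(\<Sum>t\<in>I. c t * (W t \<omega> - h t * W r \<omega>)) = (\<Sum>t\<in>J. d t * W t \<omega>)" for \<omega>
    unfolding dsum H_def by (simp add: right_diff_distrib sum_subtractf sum_distrib_right mult.assoc)
  have shift: "(\<Sum>t\<in>J. (a t + (if t = r then x else 0)) * f t) = (\<Sum>t\<in>J. a t * f t) + x * f r" for a f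
    by (simp only: distrib_right sum.distrib sum_indicator_mult[OF J])
  have cross: "(\<Sum>s\<in>J. d s * (K s r + K r s)) = 0"
  proof -
    have "(\<Sum>s\<in>J. d s * (K s r + K r s)) = 2 * K r r * (\<Sum>s\<in>J. d s * h s)"
      using K by (simp add: h_def sum_distrib_left)
    \<comment> \<open>By \<open>dsum\<close> this sum is \<open>H - H * h r\<close>, and
      \<open>h r = 1\<close>.\<close>
    also have "(\<Sum>s\<in>J. d s * h s) = 0"
      using K unfolding dsum by (simp add: H_def h_def)
    finally show ?thesis by simp
  qed
  have V: "V (\<lambda>t. d t + (if t = r then x else 0)) = V d + x\<^sup>2 * K r r"
    unfolding V_def quadratic_form_shift[OF J] cross by simp
  \<comment> \<open>The summand \<open>0\<close> presents \<open>x * W r\<close> as a shift of the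
    zero combination, so that the shift identities match.\<close>
  have V0: "V (\<lambda>t. 0 + (if t = r then x else 0)) = x\<^sup>2 * K r r"
    unfolding V_def quadratic_form_shift[OF J] by simp
  have "expectation (\<lambda>\<omega>. iexp ((\<Sum>t\<in>I. c t * (W t \<omega> - h t * W r \<omega>)) + x * W r \<omega>))
      = exp (\<i> * (\<mu> d + x * m r) - (V d + x\<^sup>2 * K r r) / 2)"
    unfolding L using E[of "\<lambda>t. d t + (if t = r then x else 0)"] unfolding shift V \<mu>_def
    by simp
  also have "\<dots> = exp (\<i> * \<mu> d - V d / 2) * exp (\<i> * (x * m r) - x\<^sup>2 * K r r / 2)"
    by (simp add: algebra_simps add_divide_distrib flip: exp_add)
  also have "exp (\<i> * \<mu> d - V d / 2) = expectation (\<lambda>\<omega>. iexp (\<Sum>t\<in>I. c t * (W t \<omega> - h t * W r \<omega>)))"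
    unfolding L E ..
  also have "exp (\<i> * (x * m r) - x\<^sup>2 * K r r / 2) = expectation (\<lambda>\<omega>. iexp (x * W r \<omega>))"
    using E[of "\<lambda>t. 0 + (if t = r then x else 0)"] unfolding V0 \<mu>_def shift by simp
  finally show ?thesis .
qed

lemma normal_rv_AE_neq:
  assumes "normal_rv M X mu v" "v > 0"
  shows "AE \<omega> in M. X \<omega> \<noteq> x"
proof -
  have D: "distributed M lborel X (normal_density mu (sqrt v))"
    using assms by (auto simp: normal_rv_def)
  have "AE y in distr M lborel X. y \<noteq> x"
    unfolding distributed_distr_eq_density[OF D] using AE_lborel_singleton[of x]
    by (subst AE_density) auto
  then show ?thesis
    using D by (subst (asm) AE_distr_iff) (auto simp: distributed_def)
qed

lemma normal_rv_cong_AE: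
  assumes "normal_rv M X mu v" and eq: "AE \<omega> in M. X \<omega> = Y \<omega>" and Y: "Y \<in> borel_measurable M"
  shows "normal_rv M Y mu v"
proof -
  have X: "X \<in> borel_measurable M" using assms by (simp add: normal_rv_def)
  have "distr M lborel X = distr M lborel Y"
    using X Y eq by (intro distr_cong_AE) auto
  moreover have "(AE \<omega> in M. X \<omega> = mu) \<longleftrightarrow> (AE \<omega> in M. Y \<omega> = mu)"
    using eq by (intro eventually_subst) (auto elim: eventually_mono)
  ultimately show ?thesis using assms(1) Y by (auto simp: normal_rv_def distributed_def)
qed

text \<open>This allows passing to a version with everywhere continuous paths. Each linear
  combination involves only finitely many times, so agreement almost surely at each single time is
  enough.\<close>

lemma gaussian_process_cong_AE:
  assumes G: "gaussian_process M W m K" and eq: "\<And>t. AE \<omega> in M. W t \<omega> = W' t \<omega>"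
    and W'[measurable]: "\<And>t. W' t \<in> borel_measurable M"
  shows "gaussian_process M W' m K"
  unfolding gaussian_process_def
proof (intro allI impI)
  fix I :: "real set" and c :: "real \<Rightarrow> real"
  assume I: "finite I"
  show "normal_rv M (\<lambda>\<omega>. \<Sum>t\<in>I. c t * W' t \<omega>) (\<Sum>t\<in>I. c t * m t) (\<Sum>s\<in>I. \<Sum>t\<in>I. c s * c t * K s t)"
  proof (rule normal_rv_cong_AE)
    show "normal_rv M (\<lambda>\<omega>. \<Sum>t\<in>I. c t * W t \<omega>) (\<Sum>t\<in>I. c t * m t) (\<Sum>s\<in>I. \<Sum>t\<in>I. c s * c t * K s t)"
      using G I by (auto simp: gaussian_process_def)
    have "AE \<omega> in M. \<forall>t\<in>I. W t \<omega> = W' t \<omega>"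
      using I eq by (simp add: AE_finite_all)
    then show "AE \<omega> in M. (\<Sum>t\<in>I. c t * W t \<omega>) = (\<Sum>t\<in>I. c t * W' t \<omega>)"
      by eventually_elim simp
  qed measurable
qed

lemma gaussian_process_normal:
  assumes "gaussian_process M W m K"
  shows "normal_rv M (W t) (m t) (K t t)"
proof -
  have "normal_rv M (\<lambda>\<omega>. \<Sum>s\<in>{t}. 1 * W s \<omega>) (\<Sum>s\<in>{t}. 1 * m s) (\<Sum>s\<in>{t}. \<Sum>u\<in>{t}. 1 * 1 * K s u)"
    using assms unfolding gaussian_process_def by (elim allE[of _ "{t}"] allE[of _ "\<lambda>_. 1"]) auto
  then show ?thesis by simp
qed

end

section \<open>Measurability of the infima and the Fubini argument\<close>

text \<open>Rounding time down to multiples of \<open>1 / Suc n\<close> leaves countably many times,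
  so each approximation is jointly measurable; by path continuity they converge pointwise to the
  process.\<close>

lemma measurable_continuous_process:
  fixes Z :: "real \<Rightarrow> 'a \<Rightarrow> real"
  assumes [measurable]: "\<And>t. Z t \<in> borel_measurable S"
    and cont: "\<And>\<omega>. \<omega> \<in> space S \<Longrightarrow> continuous_on UNIV (\<lambda>t. Z t \<omega>)"
  shows "(\<lambda>p. Z (fst p) (snd p)) \<in> borel_measurable (borel \<Otimes>\<^sub>M S)"
proof (rule borel_measurable_LIMSEQ_real)
  show "(\<lambda>p. Z (real_of_int \<lfloor>real (Suc n) * fst p\<rfloor> / Suc n) (snd p)) \<in> borel_measurable (borel \<Otimes>\<^sub>M S)" for n
    by (rule measurable_compose_countable[where f = "\<lambda>k p. Z (real_of_int k / Suc n) (snd p)"]) measurable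
  fix p :: "real \<times> 'a" assume p: "p \<in> space (borel \<Otimes>\<^sub>M S)"
  have *: "(\<lambda>n. real_of_int \<lfloor>real (Suc n) * fst p\<rfloor> / Suc n) \<longlonglongrightarrow> fst p"
  proof (rule real_tendsto_sandwich)
    show "(\<lambda>n. fst p - 1 / Suc n) \<longlonglongrightarrow> fst p"
      using tendsto_diff[OF tendsto_const LIMSEQ_inverse_real_of_nat, of "fst p"] by (simp add: inverse_eq_divide)
    show "\<forall>\<^sub>F n in sequentially. fst p - 1 / Suc n \<le> real_of_int \<lfloor>real (Suc n) * fst p\<rfloor> / Suc n"
    proof (rule always_eventually, rule allI)
      fix n
      have "real (Suc n) * fst p - 1 \<le> real_of_int \<lfloor>real (Suc n) * fst p\<rfloor>" by linarith
      then have "(real (Suc n) * fst p - 1) / Suc n \<le> real_of_int \<lfloor>real (Suc n) * fst p\<rfloor> / Suc n"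
        by (rule divide_right_mono) simp
      then show "fst p - 1 / Suc n \<le> real_of_int \<lfloor>real (Suc n) * fst p\<rfloor> / Suc n"
        by (simp add: diff_divide_distrib)
    qed
    show "\<forall>\<^sub>F n in sequentially. real_of_int \<lfloor>real (Suc n) * fst p\<rfloor> / Suc n \<le> fst p"
    proof (rule always_eventually, rule allI)
      fix n
      have "real_of_int \<lfloor>real (Suc n) * fst p\<rfloor> \<le> fst p * Suc n"
        using of_int_floor_le[of "real (Suc n) * fst p"] by (simp only: mult.commute)
      then show "real_of_int \<lfloor>real (Suc n) * fst p\<rfloor> / Suc n \<le> fst p"
        by (subst pos_divide_le_eq) auto
    qed
  qed simp
  have "isCont (\<lambda>t. Z t (snd p)) (fst p)"
    using cont[of "snd p"] p by (auto simp: space_pair_measure continuous_on_eq_continuous_at)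
  then show "(\<lambda>n. Z (real_of_int \<lfloor>real (Suc n) * fst p\<rfloor> / Suc n) (snd p)) \<longlonglongrightarrow> Z (fst p) (snd p)"
    by (rule isCont_tendsto_compose) (rule *)
qed

text \<open>Joint measurability makes each \<open>Q\<close> measurable as an integral with a
  parameter, and the infimum is over a countable set.\<close>

lemma measurable_rat_inf_Q:
  fixes Z :: "real \<Rightarrow> 'a \<Rightarrow> real"
  assumes "\<And>t. Z t \<in> borel_measurable S"
    and "\<And>\<omega>. \<omega> \<in> space S \<Longrightarrow> continuous_on UNIV (\<lambda>t. Z t \<omega>)"
  shows "(\<lambda>\<omega>. rat_inf (\<lambda>t. Q \<gamma> t (\<lambda>y. Z y \<omega>)) a b) \<in> borel_measurable S"
proof -
  have [measurable]: "(\<lambda>p. Z (snd p) (fst p)) \<in> borel_measurable (S \<Otimes>\<^sub>M lborel)"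
  proof -
    have "(\<lambda>p. (snd p, fst p)) \<in> S \<Otimes>\<^sub>M lborel \<rightarrow>\<^sub>M borel \<Otimes>\<^sub>M S" by measurable
    from measurable_compose[OF this measurable_continuous_process[OF assms]] show ?thesis by simp
  qed
  have [measurable]: "Phi \<in> borel_measurable borel"
    by (intro borel_measurable_continuous_onI continuous_on_Phi)
  have "(\<lambda>\<omega>. Q \<gamma> t (\<lambda>y. Z y \<omega>)) \<in> borel_measurable S" for t
    unfolding Q_def interval_lebesgue_integral_def set_lebesgue_integral_def by measurable
  then show ?thesis
    unfolding rat_inf_def by (intro borel_measurable_cINF_real countable_subset[OF _ countable_rat]) auto
qed

text \<open>Here \<open>S\<close> is a coarser sigma-algebra carrying the residual process
  \<open>Z\<close>. Independence lets \<open>Y\<close> be varied while the path of \<open>Z\<close>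
  is held fixed.\<close>

lemma (in prob_space) AE_rat_inf_neq:
  fixes Z :: "real \<Rightarrow> 'a \<Rightarrow> real"
  assumes rv[measurable]: "(\<lambda>\<omega>. \<omega>) \<in> M \<rightarrow>\<^sub>M S" "Y \<in> borel_measurable M"
    and indep: "distr M S (\<lambda>\<omega>. \<omega>) \<Otimes>\<^sub>M distr M borel Y = distr M (S \<Otimes>\<^sub>M borel) (\<lambda>\<omega>. (\<omega>, Y \<omega>))"
    and [simp]: "space S = space M"
    and Z[measurable]: "\<And>t. Z t \<in> borel_measurable S"
    and Zc: "\<And>\<omega>. \<omega> \<in> space M \<Longrightarrow> continuous_on UNIV (\<lambda>t. Z t \<omega>)"
    and h: "continuous_on UNIV h" "\<And>t. h t > 0"
    and Y: "\<And>x. AE \<omega> in M. Y \<omega> \<noteq> x" and le: "a < b" "b < c" "c < d"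
  shows "AE \<omega> in M. rat_inf (\<lambda>t. Q \<gamma> t (\<lambda>y. Z y \<omega> + h y * Y \<omega>)) a b \<noteq>
                     rat_inf (\<lambda>t. Q \<gamma> t (\<lambda>y. Z y \<omega> + h y * Y \<omega>)) c d"
proof -
  interpret D1: prob_space "distr M S (\<lambda>\<omega>. \<omega>)" by (rule prob_space_distr) measurable
  interpret D2: prob_space "distr M borel Y" by (rule prob_space_distr) measurable
  interpret D: pair_prob_space "distr M S (\<lambda>\<omega>. \<omega>)" "distr M borel Y" ..
  define R where "R a b p = rat_inf (\<lambda>t. Q \<gamma> t (\<lambda>y. Z y (fst p) + h y * snd p)) a b" for a b p
  have path: "continuous_on UNIV (\<lambda>y. Z y \<omega> + h y * x)" if "\<omega> \<in> space M" for \<omega> x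
    using h(1) Zc[OF that] by (intro continuous_intros)
  have [measurable]: "R a b \<in> borel_measurable (S \<Otimes>\<^sub>M borel)" for a b
    unfolding R_def using path by (intro measurable_rat_inf_Q) (auto simp: space_pair_measure)
  \<comment> \<open>In \<open>R\<close> the value \<open>x\<close> is decoupled from the sample
    point, so Fubini reduces the claim to a fixed path of \<open>Z\<close>.\<close>
  have "AE p in distr M S (\<lambda>\<omega>. \<omega>) \<Otimes>\<^sub>M distr M borel Y. R a b p \<noteq> R c d p"
  proof (rule D.AE_pair_measure)
    show "{p \<in> space (distr M S (\<lambda>\<omega>. \<omega>) \<Otimes>\<^sub>M distr M borel Y). R a b p \<noteq> R c d p}
        \<in> sets (distr M S (\<lambda>\<omega>. \<omega>) \<Otimes>\<^sub>M distr M borel Y)"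
      by measurable
    show "AE \<omega> in distr M S (\<lambda>\<omega>. \<omega>). AE x in distr M borel Y. R a b (\<omega>, x) \<noteq> R c d (\<omega>, x)"
    proof (rule AE_I2)
      fix \<omega> assume "\<omega> \<in> space (distr M S (\<lambda>\<omega>. \<omega>))"
      then have \<omega>: "\<omega> \<in> space M" by simp
      have mono: "R c d (\<omega>, x) - R a b (\<omega>, x) < R c d (\<omega>, y) - R a b (\<omega>, y)" if "x < y" for x y
        unfolding R_def using that h(2) by (intro rat_inf_diff_less) (auto intro: path \<omega> le)
      show "AE x in distr M borel Y. R a b (\<omega>, x) \<noteq> R c d (\<omega>, x)"
      \<comment> \<open>By \<open>mono\<close> at most one \<open>x\<close> gives equality, and the
        law of \<open>Y\<close> does not charge it.\<close>
      proof (cases "\<exists>x. R a b (\<omega>, x) = R c d (\<omega>, x)")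
        case True
        then obtain x where x: "R a b (\<omega>, x) = R c d (\<omega>, x)" by blast
        have "AE y in distr M borel Y. y \<noteq> x"
          using Y[of x] by (subst AE_distr_iff) auto
        then show ?thesis
        proof eventually_elim
          case (elim y)
          then show ?case using mono[of x y] mono[of y x] x by (cases x y rule: linorder_cases) auto
        qed
      qed auto
    qed
  qed
  \<comment> \<open>Independence identifies the product law with the joint law, which puts the
    actual value \<open>Y \<omega>\<close> back in place of \<open>x\<close>.\<close>
  then have "AE p in distr M (S \<Otimes>\<^sub>M borel) (\<lambda>\<omega>. (\<omega>, Y \<omega>)). R a b p \<noteq> R c d p"
    unfolding indep .
  then have "AE \<omega> in M. R a b (\<omega>, Y \<omega>) \<noteq> R c d (\<omega>, Y \<omega>)"
    by (rule AE_distrD[rotated]) measurable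
  then show ?thesis by (simp add: R_def)
qed

section \<open>Almost sure uniqueness of the minimiser by means of rational intervals\<close>

theorem theorem3:
  fixes M :: "'a measure" and W :: "real \<Rightarrow> 'a \<Rightarrow> real"
    and m :: "real \<Rightarrow> real" and K :: "real \<Rightarrow> real \<Rightarrow> real" and \<gamma> :: real
  assumes "prob_space M"
    and "gaussian_process M W m K"
    and "AE \<omega> in M. continuous_on UNIV (\<lambda>t. W t \<omega>)"
    and "continuous_on UNIV m"
    and "continuous_on UNIV (\<lambda>(s, t). K s t)"
    and "\<And>s t. K t s > 0"
  shows "AE \<omega> in M. \<forall>t1 t2. t1 \<in> argmin_set (\<lambda>t. Q \<gamma> t (\<lambda>y. W y \<omega>)) \<longrightarrow>
            t2 \<in> argmin_set (\<lambda>t. Q \<gamma> t (\<lambda>y. W y \<omega>)) \<longrightarrow> t1 = t2"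
proof -
  interpret prob_space M by fact
  note K = assms(5,6)
  have [measurable]: "W t \<in> borel_measurable M" for t
    using gaussian_process_normal[OF assms(2)] by (simp add: normal_rv_def)
  from AE_E3[OF assms(3)] obtain N where N: "N \<in> null_sets M"
    "\<And>\<omega>. \<omega> \<in> space M - N \<Longrightarrow> continuous_on UNIV (\<lambda>t. W t \<omega>)" by blast
  have [measurable]: "N \<in> events" using N by auto
  \<comment> \<open>Zero paths on the null set \<open>N\<close> make every path continuous, as the
    measurability lemmas require of each point of the space.\<close>
  define W' where "W' t \<omega> = (if \<omega> \<in> N then 0 else W t \<omega>)" for t \<omega>
  have W'[measurable]: "W' t \<in> borel_measurable M" for t
    unfolding W'_def by measurable
  have eq: "AE \<omega> in M. \<forall>t. W' t \<omega> = W t \<omega>"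
    using AE_not_in[OF N(1)] by eventually_elim (simp add: W'_def)
  have W'c: "continuous_on UNIV (\<lambda>t. W' t \<omega>)" if "\<omega> \<in> space M" for \<omega>
    using N(2)[of \<omega>] that by (cases "\<omega> \<in> N") (auto simp: W'_def)
  have G: "gaussian_process M W' m K"
    by (rule gaussian_process_cong_AE[OF assms(2) _ W']) (use eq in \<open>auto elim: eventually_mono\<close>)
  define h where "h t = (K t 0 + K 0 t) / (2 * K 0 0)" for t
  define Z where "Z t \<omega> = W' t \<omega> - h t * W' 0 \<omega>" for t \<omega>
  have h0: "h t > 0" for t using K(2) by (simp add: h_def add_pos_pos)
  have "continuous_on UNIV (\<lambda>t. (\<lambda>(s, t). K s t) (t, 0))" "continuous_on UNIV (\<lambda>t. (\<lambda>(s, t). K s t) (0, t))"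
    by (rule continuous_on_compose2[OF K(1)]; auto intro!: continuous_intros)+
  then have hc: "continuous_on UNIV h"
    unfolding h_def using K(2)[of 0 0] by (auto intro!: continuous_intros)
  have [measurable]: "Z t \<in> borel_measurable M" for t unfolding Z_def by measurable
  have factor: "expectation (\<lambda>\<omega>. iexp ((\<Sum>t\<in>I. c t * Z t \<omega>) + x * W' 0 \<omega>)) =
      expectation (\<lambda>\<omega>. iexp (\<Sum>t\<in>I. c t * Z t \<omega>)) * expectation (\<lambda>\<omega>. iexp (x * W' 0 \<omega>))"
    if "finite I" for I c x
    unfolding Z_def h_def by (rule gaussian_residual_iexp[OF G K(2) that])
  note indep = indep_cylinder_algebra[of Z, OF _ W' factor, simplified]
  \<comment> \<open>Endpoints of type \<open>rat\<close> form a countable family, so the exceptional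
    null sets can be united afterwards; there \<open>Z y + h y * W' 0\<close> collapses back to
    \<open>W' y\<close>.\<close>
  have "AE \<omega> in M. rat_inf (\<lambda>t. Q \<gamma> t (\<lambda>y. Z y \<omega> + h y * W' 0 \<omega>)) (of_rat a) (of_rat b) \<noteq>
      rat_inf (\<lambda>t. Q \<gamma> t (\<lambda>y. Z y \<omega> + h y * W' 0 \<omega>)) (of_rat c) (of_rat d)"
    if "a < b" "b < c" "c < d" for a b c d :: rat
  proof (rule AE_rat_inf_neq[OF indep(1) W' indep(2)])
    show "Z t \<in> borel_measurable (cylinder_algebra Z)" for t
      by (rule measurable_cylinder_algebra)
    show "continuous_on UNIV (\<lambda>t. Z t \<omega>)" if "\<omega> \<in> space M" for \<omega>
      unfolding Z_def using W'c[OF that] hc by (intro continuous_intros)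
    show "AE \<omega> in M. W' 0 \<omega> \<noteq> x" for x
      by (rule normal_rv_AE_neq[OF gaussian_process_normal[OF G] K(2)])
  qed (use that hc h0 in \<open>auto simp: of_rat_less\<close>)
  then have "AE \<omega> in M. \<forall>a b c d. a < b \<longrightarrow> b < c \<longrightarrow> c < d \<longrightarrow>
      rat_inf (\<lambda>t. Q \<gamma> t (\<lambda>y. W' y \<omega>)) (of_rat a) (of_rat b) \<noteq>
      rat_inf (\<lambda>t. Q \<gamma> t (\<lambda>y. W' y \<omega>)) (of_rat c) (of_rat d)"
    by (simp add: AE_all_countable Z_def)
  with eq AE_space show ?thesis
  proof eventually_elim
    case (elim \<omega>)
    then have Wc: "continuous_on UNIV (\<lambda>t. W t \<omega>)" using W'c[of \<omega>] by simp
    let ?q = "\<lambda>t. Q \<gamma> t (\<lambda>y. W y \<omega>)"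
    have neq: "rat_inf ?q (of_rat a) (of_rat b) \<noteq> rat_inf ?q (of_rat c) (of_rat d)"
      if "a < b" "b < c" "c < d" for a b c d :: rat
      using elim that by simp
    have False if t: "t1 \<in> argmin_set ?q" "t2 \<in> argmin_set ?q" and "t1 < t2" for t1 t2
    proof -
      \<comment> \<open>The midpoint of \<open>t1\<close> and \<open>t2\<close> separates two
        rational intervals, each with one minimiser in its interior. The infima over them are the
        values at these points, both equal to the global minimum.\<close>
      obtain a b where ab: "t1 - 1 < of_rat a" "of_rat a < t1" "t1 < of_rat b" "of_rat b < (t1 + t2) / 2"
        using of_rat_dense[of "t1 - 1" t1] of_rat_dense[of t1 "(t1 + t2) / 2"] \<open>t1 < t2\<close> by auto
      obtain c d where cd: "(t1 + t2) / 2 < of_rat c" "of_rat c < t2" "t2 < of_rat d"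
        using of_rat_dense[of "(t1 + t2) / 2" t2] of_rat_dense[of t2 "t2 + 1"] \<open>t1 < t2\<close> by auto
      have "real_of_rat a < of_rat b" "real_of_rat b < of_rat c" "real_of_rat c < of_rat d"
        using ab cd by auto
      then have "rat_inf ?q (of_rat a) (of_rat b) \<noteq> rat_inf ?q (of_rat c) (of_rat d)"
        by (intro neq) (auto simp: of_rat_less)
      moreover have "rat_inf ?q (of_rat a) (of_rat b) = ?q t1" "rat_inf ?q (of_rat c) (of_rat d) = ?q t2"
        using ab cd by (auto intro!: rat_inf_argmin t continuous_on_Q Wc)
      moreover have "?q t1 = ?q t2" using t by (intro antisym) (auto simp: argmin_set_def)
      ultimately show False by simp
    qed
    then show ?case by (metis linorder_neqE_linordered_idom)
  qed
qed

end
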